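(* In $A_5$ let $a=(1\,2)(3\,4)$, $b=(1\,2\,3\,4\,5)$ and $c=(1\,2\,3)$. Define the following two-element generating sets $C_n$ of $A_5^n$, $1 \leq n \leq 8$: \begin{align*} C_1&=\{a,b\},\\ C_2&=\{(a,b),\,(b,a)\},\\ C_3&=\{(a,b,a),\,(b,a,b^2)\},\\ C_4&=\{(a,b,a,b^2),\,(b,a,b^2,a)\},\\ C_5&=\{(a,b,a,b^2,c),\,(b,a,b^2,a,b)\},\\ C_6&=\{(a,b,a,b^2,c,b),\,(b,a,b^2,a,b,c)\},\\ C_7&=\{(a,b,a,b^2,c,b,c),\,(b,a,b^2,a,b,c,b^2)\},\\ C_8&=\{(a,b,a,b^2,c,b,c,b^2),\,(b,a,b^2,a,b,c,b^2,c)\}. \end{align*} Then for every $n$ with $1 \leq n \leq 8$ one has $\mathrm{diam}(A_5^n, C_n) \leq 58\,n$.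
   Context: $A_5$ is the alternating group on 5 letters and $A_5^n$ is its $n$-fold direct power. A subset $A$ of a finite group $G$ is a generating set of $G$ if every element of $G$ is a product of elements of $A$ (inverses are not needed because $G$ is finite). For a generating set $A$ of $G$ and $g \in G$, the length $l_A(g)$ is the minimum length of a word in elements of $A$ (no inverses allowed) whose product is $g$, with $l_A(1)=0$. The diameter is $\mathrm{diam}(G,A) := \max\{l_A(g) : g \in G\}$. *)

theory Defs
  imports "HOL-Algebra.Sym_Groups" "HOL-Algebra.Product_Groups"
begin

definition word_prod :: "('g, 'm) monoid_scheme \<Rightarrow> 'g list \<Rightarrow> 'g" where
  "word_prod G ws = foldr (mult G) ws (one G)"

text \<open>
  Words contain no inverses. This is the notion of generation for finite groups only; for an
  infinite group it says that \<open>A\<close> generates \<open>G\<close> as a monoid.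
\<close>

definition generating_set :: "('g, 'm) monoid_scheme \<Rightarrow> 'g set \<Rightarrow> bool" where
  "generating_set G A \<longleftrightarrow>
     A \<subseteq> carrier G \<and> (\<forall>g\<in>carrier G. \<exists>ws. set ws \<subseteq> A \<and> word_prod G ws = g)"

definition word_length :: "('g, 'm) monoid_scheme \<Rightarrow> 'g set \<Rightarrow> 'g \<Rightarrow> nat" where
  "word_length G A g = (LEAST k. \<exists>ws. set ws \<subseteq> A \<and> length ws = k \<and> word_prod G ws = g)"

text \<open>Meaningful when \<open>G\<close> is finite and \<open>A\<close> is a generating set of \<open>G\<close>.\<close>

definition diam :: "('g, 'm) monoid_scheme \<Rightarrow> 'g set \<Rightarrow> nat" where
  "diam G A = Max {word_length G A g | g. g \<in> carrier G}"

abbreviation A5 :: "(nat \<Rightarrow> nat) monoid" where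
  "A5 \<equiv> alt_group 5"

abbreviation A5_power :: "nat \<Rightarrow> (nat \<Rightarrow> nat \<Rightarrow> nat) monoid" where
  "A5_power n \<equiv> product_group {..<n} (\<lambda>_. A5)"

definition perm_a :: "nat \<Rightarrow> nat" where
  "perm_a = cycle_of_list [1, 2] \<otimes>\<^bsub>A5\<^esub> cycle_of_list [3, 4]"

definition perm_b :: "nat \<Rightarrow> nat" where
  "perm_b = cycle_of_list [1, 2, 3, 4, 5]"

definition perm_b2 :: "nat \<Rightarrow> nat" where
  "perm_b2 = perm_b [^]\<^bsub>A5\<^esub> (2::nat)"

definition perm_c :: "nat \<Rightarrow> nat" where
  "perm_c = cycle_of_list [1, 2, 3]"

text \<open>The list \<open>[x\<^sub>1, \<dots>, x\<^sub>n]\<close> as an element of the product indexed by \<open>{..<n}\<close>.\<close>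

definition tuple :: "'a list \<Rightarrow> nat \<Rightarrow> 'a" where
  "tuple xs = (\<lambda>i\<in>{..<length xs}. xs ! i)"

text \<open>
  Only used for \<open>1 \<le> n \<le> 8\<close>. The elements of \<open>C 1\<close> are 1-tuples: \<open>A\<^sub>5\<close> is identified
  with \<open>A\<^sub>5\<^sup>1\<close>.
\<close>

definition C :: "nat \<Rightarrow> (nat \<Rightarrow> nat \<Rightarrow> nat) set" where
  "C n = (let a = perm_a; b = perm_b; b2 = perm_b2; c = perm_c in
     [{tuple [a], tuple [b]},
      {tuple [a, b], tuple [b, a]},
      {tuple [a, b, a], tuple [b, a, b2]},
      {tuple [a, b, a, b2], tuple [b, a, b2, a]},
      {tuple [a, b, a, b2, c], tuple [b, a, b2, a, b]},
      {tuple [a, b, a, b2, c, b], tuple [b, a, b2, a, b, c]},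
      {tuple [a, b, a, b2, c, b, c], tuple [b, a, b2, a, b, c, b2]},
      {tuple [a, b, a, b2, c, b, c, b2], tuple [b, a, b2, a, b, c, b2, c]}] ! (n - 1))"

end

(*
  The generating pairs are nested: C_n consists of the first n coordinates of C_8. If for every
  coordinate k there are short words that are trivial in all coordinates before k and take every
  value of A_5 in coordinate k, then an element of A_5^n can be reached by correcting its
  coordinates from the first to the last, and the diameter is at most the sum of the bounds of
  the layers. For each layer a computer search (a birthday collision search among words of
  moderate length) found a few words such that the products of at most two of them suffice.
  That the products exhaust A_5 is seen by counting 60 different values, so that no description
  of the even permutations is needed.
*)
theory Submission
  imports Defs
begin

section \<open>Words in direct products\<close>

lemma word_prod_Nil [simp]: "word_prod G [] = \<one>\<^bsub>G\<^esub>"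
  by (simp add: word_prod_def)

lemma word_prod_Cons [simp]: "word_prod G (x # xs) = x \<otimes>\<^bsub>G\<^esub> word_prod G xs"
  by (simp add: word_prod_def)

lemma (in monoid) word_prod_closed [simp]: "set xs \<subseteq> carrier G \<Longrightarrow> word_prod G xs \<in> carrier G"
  by (induction xs) auto

lemma (in monoid) word_prod_append:
  "set xs \<subseteq> carrier G \<Longrightarrow> set ys \<subseteq> carrier G \<Longrightarrow>
    word_prod G (xs @ ys) = word_prod G xs \<otimes> word_prod G ys"
  by (induction xs) (auto simp: m_assoc)

lemma word_prod_product_group:
  "word_prod (product_group I G) (map (\<lambda>l. \<lambda>i\<in>I. s i l) w) =
    (\<lambda>i\<in>I. word_prod (G i) (map (s i) w))"
  by (induction w) (auto simp: fun_eq_iff)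

text \<open>One word over abstract letters is read in every coordinate at once through
  \<open>s i\<close>. If \<open>w\<close> is correct in the coordinates before \<open>m\<close> and
  takes the value \<open>p\<close> in coordinate \<open>m\<close>, then appending a layer word of
  value \<open>p\<close>^-1 * \<open>g m\<close> repairs coordinate \<open>m\<close> and leaves the
  earlier ones alone; later coordinates may change freely. The induction runs on \<open>m\<close>
  with \<open>n\<close> fixed.\<close>

lemma triangular_words:
  fixes G :: "nat \<Rightarrow> ('g, 'm) monoid_scheme" and s :: "nat \<Rightarrow> 'l \<Rightarrow> 'g"
  assumes group: "\<And>i. i < n \<Longrightarrow> group (G i)"
    and s: "\<And>i l. i < n \<Longrightarrow> s i l \<in> carrier (G i)"
    and layer: "\<And>k h. k < n \<Longrightarrow> h \<in> carrier (G k) \<Longrightarrow>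
      \<exists>u. length u \<le> L k \<and> (\<forall>i<k. word_prod (G i) (map (s i) u) = \<one>\<^bsub>G i\<^esub>) \<and>
        word_prod (G k) (map (s k) u) = h"
    and g: "\<And>i. i < n \<Longrightarrow> g i \<in> carrier (G i)"
    and "m \<le> n"
  shows "\<exists>w. length w \<le> sum L {..<m} \<and> (\<forall>i<m. word_prod (G i) (map (s i) w) = g i)"
  using \<open>m \<le> n\<close>
proof (induction m)
  case 0
  then show ?case by simp
next
  case (Suc m)
  then obtain w where w: "length w \<le> sum L {..<m}" "\<And>i. i < m \<Longrightarrow> word_prod (G i) (map (s i) w) = g i"
    by auto
  have closed: "set (map (s i) v) \<subseteq> carrier (G i)" if "i < n" for i v
    using s[OF that] by auto
  interpret Gm: group "G m"
    using group Suc.prems by simp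
  define p where "p = word_prod (G m) (map (s m) w)"
  have p: "p \<in> carrier (G m)"
    unfolding p_def using closed Suc.prems by (intro Gm.word_prod_closed) simp
  have gm: "g m \<in> carrier (G m)"
    using g Suc.prems by simp
  obtain u where u: "length u \<le> L m" "\<And>i. i < m \<Longrightarrow> word_prod (G i) (map (s i) u) = \<one>\<^bsub>G i\<^esub>"
    "word_prod (G m) (map (s m) u) = inv\<^bsub>G m\<^esub> p \<otimes>\<^bsub>G m\<^esub> g m"
    using layer[of m "inv\<^bsub>G m\<^esub> p \<otimes>\<^bsub>G m\<^esub> g m"] p gm Suc.prems by auto
  have "word_prod (G i) (map (s i) (w @ u)) = g i" if "i < Suc m" for i
  proof -
    have "i < n"
      using that Suc.prems by simp
    interpret Gi: group "G i"
      using group[OF \<open>i < n\<close>] .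
    have *: "word_prod (G i) (map (s i) (w @ u)) =
        word_prod (G i) (map (s i) w) \<otimes>\<^bsub>G i\<^esub> word_prod (G i) (map (s i) u)"
      using Gi.word_prod_append[OF closed[OF \<open>i < n\<close>] closed[OF \<open>i < n\<close>]] by simp
    show ?thesis
    proof (cases "i = m")
      case True
      then show ?thesis
        using * u(3) p gm by (simp flip: p_def Gm.m_assoc)
    next
      case False
      then show ?thesis
        using * w(2) u(2) g[OF \<open>i < n\<close>] that by simp
    qed
  qed
  moreover have "length (w @ u) \<le> sum L {..<Suc m}"
    using w(1) u(1) by simp
  ultimately show ?case
    by blast
qed

lemma diam_le:
  assumes "finite (carrier G)" "carrier G \<noteq> {}"
    and "\<And>g. g \<in> carrier G \<Longrightarrow> \<exists>ws. set ws \<subseteq> A \<and> length ws \<le> d \<and> word_prod G ws = g"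
  shows "diam G A \<le> d"
proof -
  have "word_length G A g \<le> d" if g: "g \<in> carrier G" for g
  proof -
    obtain ws where ws: "set ws \<subseteq> A" "length ws \<le> d" "word_prod G ws = g"
      using assms(3)[OF g] by blast
    have "word_length G A g \<le> length ws"
      unfolding word_length_def by (rule Least_le) (use ws in blast)
    then show ?thesis
      using ws by simp
  qed
  moreover have "{word_length G A g | g. g \<in> carrier G} = word_length G A ` carrier G"
    by blast
  ultimately show ?thesis
    unfolding diam_def using assms by auto
qed

section \<open>Executable permutations of five points\<close>

datatype point = P1 | P2 | P3 | P4 | P5

text \<open>A table of images made of constructors, so that composing and comparing are pure pattern
  matching for \<open>code_simp\<close>. The type also contains tables of non-bijective maps;
  membership in A_5 is proved separately, for the generators and for the values of words.\<close>

datatype perm = Perm point point point point point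

primrec number :: "point \<Rightarrow> nat" where
  "number P1 = 1"
| "number P2 = 2"
| "number P3 = 3"
| "number P4 = 4"
| "number P5 = 5"

fun image_at :: "perm \<Rightarrow> point \<Rightarrow> point" where
  "image_at (Perm p q r s t) P1 = p"
| "image_at (Perm p q r s t) P2 = q"
| "image_at (Perm p q r s t) P3 = r"
| "image_at (Perm p q r s t) P4 = s"
| "image_at (Perm p q r s t) P5 = t"

fun compose :: "perm \<Rightarrow> perm \<Rightarrow> perm" where
  "compose f (Perm p q r s t) =
    Perm (image_at f p) (image_at f q) (image_at f r) (image_at f s) (image_at f t)"

fun perm_fun :: "perm \<Rightarrow> nat \<Rightarrow> nat" where
  "perm_fun (Perm p q r s t) =
    id(1 := number p, 2 := number q, 3 := number r, 4 := number s, 5 := number t)"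

declare perm_fun.simps [simp del]

abbreviation identity :: perm where
  "identity \<equiv> Perm P1 P2 P3 P4 P5"

lemma number_eq_iff [simp]: "number p = number q \<longleftrightarrow> p = q"
  by (cases p; cases q) simp_all

lemma perm_fun_number: "perm_fun f (number p) = number (image_at f p)"
  by (cases f; cases p) (simp_all add: perm_fun.simps)

lemma perm_fun_outside: "n \<notin> range number \<Longrightarrow> perm_fun f n = n"
proof -
  assume "n \<notin> range number"
  then have "n \<noteq> number P1" "n \<noteq> number P2" "n \<noteq> number P3" "n \<noteq> number P4" "n \<noteq> number P5"
    by blast+
  then show ?thesis
    by (cases f) (simp add: perm_fun.simps)
qed

lemma perm_fun_compose: "perm_fun (compose f g) = perm_fun f \<circ> perm_fun g"
proof
  have image: "image_at (compose f g) p = image_at f (image_at g p)" for p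
    by (cases g; cases p) simp_all
  fix n
  show "perm_fun (compose f g) n = (perm_fun f \<circ> perm_fun g) n"
    by (cases "n \<in> range number") (auto simp: perm_fun_number perm_fun_outside image)
qed

text \<open>Lets a count of distinct tables pass to a count of distinct elements of A_5, and
  identities between functions pass back to tables.\<close>

lemma inj_perm_fun: "inj perm_fun"
proof (rule injI)
  fix f g
  assume "perm_fun f = perm_fun g"
  then have "number (image_at f p) = number (image_at g p)" for p
    by (metis perm_fun_number)
  then have "image_at f p = image_at g p" for p
    by simp
  from this[of P1] this[of P2] this[of P3] this[of P4] this[of P5] show "f = g"
    by (cases f; cases g) simp
qed

lemma perm_fun_identity: "perm_fun identity = id"
  by (simp add: fun_eq_iff perm_fun.simps)

section \<open>The permutations a, b, c and b^2: their tables and their membership in A_5\<close>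

lemma perm_a_eq: "perm_a = perm_fun (Perm P2 P1 P4 P3 P5)"
  unfolding perm_a_def alt_group_mult by (auto simp: fun_eq_iff transpose_def perm_fun.simps)

lemma perm_b_eq: "perm_b = perm_fun (Perm P2 P3 P4 P5 P1)"
  unfolding perm_b_def by (auto simp: fun_eq_iff transpose_def perm_fun.simps)

lemma perm_c_eq: "perm_c = perm_fun (Perm P2 P3 P1 P4 P5)"
  unfolding perm_c_def by (auto simp: fun_eq_iff transpose_def perm_fun.simps)

lemma perm_b2_eq: "perm_b2 = perm_fun (Perm P3 P4 P5 P1 P2)"
proof -
  have "perm_b2 = perm_b \<circ> perm_b"
    unfolding perm_b2_def by (simp add: numeral_2_eq_2 nat_pow_def alt_group_one alt_group_mult)
  then show ?thesis
    by (simp add: perm_b_eq flip: perm_fun_compose)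
qed

text \<open>Each further entry of the list contributes one transposition, which flips the parity.
  The empty list would break the pattern: it gives the identity, which is even.\<close>

lemma evenperm_cycle_of_list:
  "distinct cs \<Longrightarrow> cs \<noteq> [] \<Longrightarrow> evenperm (cycle_of_list cs) \<longleftrightarrow> odd (length cs)"
proof (induction cs rule: cycle_of_list.induct)
  case (1 i j cs)
  then show ?case
    by (simp add: evenperm_comp permutation_swap_id permutation_of_cycle evenperm_swap del: o_apply)
qed (simp_all add: evenperm_id)

lemma cycle_of_list_in_alt_group:
  assumes "distinct cs" "set cs \<subseteq> {1..n}" "odd (length cs)"
  shows "cycle_of_list cs \<in> carrier (alt_group n)"
proof -
  have "cycle_of_list cs permutes {1..n}"
    using permutes_subset[OF cycle_permutes assms(2)] .
  then show ?thesis
    using assms evenperm_cycle_of_list[of cs] by (cases "cs = []") (auto simp: alt_group_carrier)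
qed

lemma perm_a_in_A5: "perm_a \<in> carrier A5"
proof -
  \<comment> \<open>(1 2)(3 4) is not a single cycle, so the criterion for cycles of odd length is
    applied to two 3-cycles with this product.\<close>
  have "perm_a = cycle_of_list [1, 2, 3] \<circ> cycle_of_list [2, 3, 4]"
    unfolding perm_a_def alt_group_mult by (auto simp: fun_eq_iff transpose_def)
  moreover have "cycle_of_list [1, 2, 3] \<in> carrier A5" "cycle_of_list [2, 3, 4] \<in> carrier A5"
    by (rule cycle_of_list_in_alt_group; simp)+
  moreover have "monoid A5"
    using alt_group_is_group group.is_monoid by blast
  ultimately show ?thesis
    by (metis monoid.m_closed alt_group_mult)
qed

lemma perm_b_in_A5: "perm_b \<in> carrier A5"
  unfolding perm_b_def by (rule cycle_of_list_in_alt_group) auto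

lemma perm_c_in_A5: "perm_c \<in> carrier A5"
  unfolding perm_c_def by (rule cycle_of_list_in_alt_group) auto

lemma perm_b2_in_A5: "perm_b2 \<in> carrier A5"
  unfolding perm_b2_def
  by (intro monoid.nat_pow_closed group.is_monoid alt_group_is_group perm_b_in_A5)

section \<open>The words\<close>

datatype letter = X | Y

primrec pick :: "perm \<times> perm \<Rightarrow> letter \<Rightarrow> perm" where
  "pick c X = fst c"
| "pick c Y = snd c"

text \<open>The columns of C_8: entry \<open>i\<close> holds coordinate \<open>i\<close> of both
  generators, the values of the letters \<open>X\<close> and \<open>Y\<close> there.\<close>

definition coords :: "(perm \<times> perm) list" where
  "coords =
    (let a = Perm P2 P1 P4 P3 P5; b = Perm P2 P3 P4 P5 P1;
         b2 = Perm P3 P4 P5 P1 P2; c = Perm P2 P3 P1 P4 P5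
     in [(a, b), (b, a), (a, b2), (b2, a), (c, b), (b, c), (c, b2), (b2, c)])"

definition evaluate :: "perm \<times> perm \<Rightarrow> letter list \<Rightarrow> perm" where
  "evaluate c w = foldr (compose \<circ> pick c) w identity"

text \<open>Entry \<open>k\<close> serves coordinate \<open>k\<close>, counted from 0. Some words
  are powers with a visible reason: a, b and b^2 have orders 2, 5 and 5, so ten copies of
  \<open>X\<close> are trivial in coordinates 0 to 3, while c^10 = c in coordinate 4; ten copies of
  \<open>Y\<close> do the same for coordinate 5.\<close>

definition layers :: "letter list list list" where
  "layers =
   [
    [[X],
     [Y,X],
     [X,Y,Y,Y],
     [Y,X,Y,Y],
     [X,Y,X,Y,Y],
     [X,Y,Y,X,Y],
     [X,Y,Y,Y,X],
     [Y,X,Y,Y,Y],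
     [Y,Y,X,Y,Y]],
    [[X,X],
     [X,X,X,X,X,X],
     [Y,X,X,Y,Y,Y,Y],
     [X,X,X,X,X,X,X,X],
     [Y,X,Y,X,X,X,Y,X],
     [Y,X,X,Y,X,X,Y,Y,Y],
     [X,X,Y,X,X,X,X,Y,Y,Y,Y],
     [X,Y,X,Y,Y,Y,Y,Y,Y,X,Y],
     [Y,X,Y,X,Y,Y,Y,Y,Y,Y,X]],
    [[X,Y,X,Y,X,Y],
     [X,X,Y,X,Y,X,Y,Y,X,Y,X,Y],
     [X,Y,X,X,Y,X,Y,X,Y,Y,X,Y],
     [X,Y,X,Y,X,Y,X,Y,X,Y,X,Y],
     [Y,X,X,X,Y,Y,Y,Y,X,Y,Y,Y,Y,X,Y,Y,Y],
     [X,X,X,Y,X,Y,X,Y,Y,X,Y,X,Y,Y,X,Y,X,Y],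
     [X,X,Y,X,Y,X,Y,X,Y,X,Y,X,Y,Y,X,Y,X,Y],
     [X,Y,X,X,Y,X,Y,X,X,Y,X,Y,X,Y,Y,Y,X,Y],
     [X,Y,Y,X,Y,Y,Y,X,Y,X,Y,Y,X,Y,Y,Y,X,Y]],
    [[X,X,Y,X,X,Y,X,X,Y,X,X,Y,X,X,Y],
     [X,Y,X,X,Y,X,X,Y,X,X,Y,X,X,Y,X],
     [Y,X,X,Y,X,X,Y,X,X,Y,X,X,Y,X,X],
     [X,X,X,Y,X,X,X,X,Y,X,X,X,X,Y,Y,Y,X],
     [X,X,Y,X,X,X,X,Y,X,X,X,X,Y,X,X,Y,Y],
     [X,Y,X,X,X,X,Y,X,X,X,X,Y,X,X,Y,Y,X],
     [Y,X,X,Y,X,X,X,X,Y,X,X,X,X,Y,X,X,Y],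
     [X,X,X,Y,X,X,X,X,X,X,Y,X,X,X,X,X,X,Y,X,X,Y,Y,X],
     [X,X,Y,X,X,Y,X,X,X,Y,X,X,Y,X,X,Y,X,X,Y,Y,X,Y,Y,Y],
     [X,Y,X,X,Y,X,X,X,Y,X,X,Y,X,X,Y,X,X,Y,Y,X,Y,Y,Y,X],
     [Y,X,X,Y,X,X,X,Y,X,X,Y,X,X,Y,X,X,Y,Y,X,Y,X,X,Y,Y]],
    [[X,X,X,X,X,X,X,X,X,X],
     [X,X,X,X,X,X,X,X,Y,Y,X,X,Y,Y,Y,Y,Y,Y,Y,Y],
     [X,X,X,X,X,X,X,X,Y,Y,Y,Y,Y,Y,Y,Y,X,X,Y,Y],
     [X,X,X,X,X,X,Y,Y,Y,Y,Y,Y,X,X,Y,Y,Y,Y,X,X],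
     [X,X,X,X,X,Y,X,X,X,X,Y,Y,Y,Y,X,Y,Y,Y,Y,Y],
     [X,X,X,X,X,Y,Y,X,X,Y,Y,Y,Y,Y,Y,X,X,Y,Y,X],
     [X,X,X,X,Y,X,X,X,X,Y,Y,X,Y,Y,Y,Y,Y,X,Y,Y],
     [X,X,X,X,Y,Y,X,X,Y,Y,X,X,Y,Y,Y,Y,X,X,Y,Y],
     [X,X,X,X,Y,Y,Y,X,Y,Y,Y,Y,X,X,X,X,Y,X,Y,Y]],
    [[Y,Y,Y,Y,Y,Y,Y,Y,Y,Y],
     [X,X,X,X,X,X,X,X,Y,X,X,Y,Y,Y,Y,X,X,X,X,X,X,X,X,Y,X,X,Y,Y,Y,Y],
     [X,X,X,X,X,X,X,Y,X,X,X,X,X,X,X,X,Y,Y,Y,Y,X,X,Y,X,X,Y,Y,Y,Y,X],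
     [X,X,Y,X,X,X,X,X,X,X,X,Y,Y,Y,Y,X,X,Y,X,X,X,X,X,X,X,X,Y,Y,Y,Y],
     [X,X,Y,X,Y,Y,X,X,Y,Y,X,X,Y,X,Y,Y,X,Y,Y,Y,Y,Y,Y,Y,Y,Y,Y,X,Y,Y],
     [X,X,Y,X,Y,Y,Y,Y,X,X,X,X,Y,Y,Y,Y,Y,Y,Y,Y,Y,Y,Y,X,Y,Y,Y,Y,X,X],
     [X,X,Y,Y,X,X,Y,X,Y,Y,Y,Y,X,Y,Y,X,X,Y,Y,Y,Y,Y,Y,Y,Y,X,Y,X,Y,Y],
     [X,X,Y,Y,X,X,Y,Y,X,Y,Y,Y,Y,Y,X,Y,Y,X,X,Y,Y,X,X,Y,Y,Y,Y,Y,Y,Y],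
     [X,X,Y,Y,X,Y,X,X,Y,Y,Y,Y,X,Y,Y,X,X,Y,Y,Y,Y,Y,Y,Y,Y,Y,X,X,Y,Y]],
    [[X,X,X,X,Y,Y,Y,Y,X,Y,X,X,X,X,Y,Y,Y,Y,X,Y],
     [X,X,X,Y,X,Y,Y,Y,Y,X,X,X,X,Y,X,Y,Y,Y,Y,X],
     [X,Y,X,Y,X,Y,X,Y,X,Y,X,Y,X,Y,X,Y,X,Y,X,Y,X,Y,X,Y,X,Y,X,Y,X,Y],
     [Y,X,Y,X,Y,X,Y,X,Y,X,Y,X,Y,X,Y,X,Y,X,Y,X,Y,X,Y,X,Y,X,Y,X,Y,X],
     [X,X,Y,X,Y,X,Y,X,Y,Y,X,Y,X,X,Y,Y,X,X,Y,X,Y,X,Y,X,Y,Y,X,Y,X,X,Y,Y],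
     [X,Y,X,X,Y,Y,Y,X,X,X,Y,Y,X,Y,X,Y,X,Y,X,X,Y,X,X,Y,Y,X,Y,Y,X,Y,X,Y],
     [X,Y,X,Y,X,Y,X,Y,Y,X,Y,X,X,Y,Y,X,X,Y,X,Y,X,Y,X,Y,Y,X,Y,X,X,Y,Y,X],
     [X,Y,X,Y,X,Y,X,Y,Y,X,Y,Y,X,X,Y,X,X,Y,X,Y,X,Y,X,Y,Y,X,X,X,Y,Y,Y,X],
     [X,Y,X,Y,X,Y,Y,X,Y,Y,X,X,Y,X,X,Y,X,Y,X,Y,X,Y,Y,X,X,X,Y,Y,Y,X,X,Y],
     [Y,X,Y,X,Y,X,Y,Y,X,Y,X,X,Y,Y,X,X,Y,X,Y,X,Y,X,Y,Y,X,Y,X,X,Y,Y,X,X],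
     [Y,X,Y,X,Y,Y,X,Y,Y,X,X,Y,X,X,Y,X,Y,X,Y,X,Y,Y,X,X,X,Y,Y,Y,X,X,Y,X]],
    [[X,X,Y,Y,X,X,Y,Y,Y,Y,Y,X,X,X,X,Y,X,X,X,X,Y,Y,Y,Y,Y,Y,Y,Y,X,X,X,X,X,X,Y,X,X,X,X,X,X,Y,X,X,Y,Y,X,X,X,X],
     [X,X,Y,Y,Y,Y,X,Y,Y,Y,Y,X,Y,Y,X,X,Y,Y,Y,X,Y,X,Y,Y,X,X,Y,Y,Y,Y,X,X,Y,X,X,Y,Y,X,X,Y,X,X,Y,Y,X,X,Y,Y,Y,Y],
     [X,Y,X,Y,Y,Y,X,X,Y,Y,X,Y,Y,Y,Y,X,Y,Y,X,X,Y,Y,Y,Y,X,X,Y,Y,Y,Y,X,X,Y,X,X,Y,Y,X,X,Y,Y,Y,X,X,Y,Y,Y,Y,X,X],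
     [Y,X,X,Y,Y,Y,Y,X,X,Y,X,X,Y,Y,X,X,Y,X,X,Y,Y,Y,Y,Y,Y,X,X,X,Y,Y,Y,X,X,Y,Y,X,Y,Y,Y,Y,X,X,X,Y,Y,Y,Y,Y,X,Y],
     [Y,X,Y,Y,Y,Y,Y,X,X,X,Y,Y,Y,Y,X,Y,Y,X,X,Y,Y,Y,X,X,X,Y,Y,Y,Y,Y,Y,X,X,Y,X,X,Y,Y,X,X,Y,X,X,Y,Y,Y,Y,X,X,Y],
     [X,Y,Y,X,X,Y,X,Y,X,X,Y,X,X,X,X,X,X,Y,X,X,Y,Y,X,Y,Y,X,Y,X,X,X,Y,X,X,X,X,X,X,Y,X,X,Y,Y,Y,X,Y,X,X,Y,Y,X,X,Y],
     [X,Y,Y,X,Y,Y,X,X,Y,X,X,X,X,X,X,Y,X,X,Y,X,Y,X,X,Y,Y,X,Y,X,X,Y,Y,X,X,Y,X,Y,Y,Y,X,X,Y,X,X,X,X,X,X,Y,X,X,X,Y],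
     [X,X,X,Y,Y,Y,X,X,X,Y,X,X,Y,X,X,X,X,Y,Y,Y,X,X,X,Y,X,X,Y,X,X,X,Y,X,X,X,Y,Y,Y,X,X,X,X,Y,X,X,Y,X,X,X,Y,Y,Y,X,X,X,X,Y]]]"

definition layer_lengths :: "nat list" where
  "layer_lengths = [5, 11, 18, 24, 20, 30, 32, 56]"

text \<open>Adjoining \<open>identity\<close> admits products of fewer than two words; removing
  duplicates makes the length a count of distinct values.\<close>

definition pair_products :: "perm list \<Rightarrow> perm list" where
  "pair_products ps =
    remdups (map (\<lambda>(p, q). compose p q) (List.product (identity # ps) (identity # ps)))"

lemma layers_trivial_before:
  "list_all (\<lambda>k. list_all (\<lambda>w. list_all (\<lambda>c. evaluate c w = identity) (take k coords)) (layers ! k)) [0..<8]"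
  by code_simp

lemma layers_cover:
  "list_all (\<lambda>k. length (pair_products (map (evaluate (coords ! k)) (layers ! k))) = 60) [0..<8]"
  by code_simp

lemma layers_short:
  "list_all (\<lambda>k. list_all (\<lambda>w. length w \<le> layer_lengths ! k) (layers ! k)) [0..<8]"
  by code_simp

section \<open>Transfer of the computed facts to A_5\<close>

definition gen :: "nat \<Rightarrow> letter \<Rightarrow> nat \<Rightarrow> nat" where
  "gen i l = perm_fun (pick (coords ! i) l)"

lemma length_coords [simp]: "length coords = 8"
  by (simp add: coords_def Let_def)

lemma gen_in_A5:
  assumes "i < 8"
  shows "gen i l \<in> carrier A5"
proof -
  have "perm_fun (fst c) \<in> carrier A5 \<and> perm_fun (snd c) \<in> carrier A5" if "c \<in> set coords" for c
    using that perm_a_in_A5 perm_b_in_A5 perm_c_in_A5 perm_b2_in_A5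
    unfolding perm_a_eq perm_b_eq perm_c_eq perm_b2_eq
    by (auto simp: coords_def Let_def)
  then show ?thesis
    using assms by (cases l) (simp_all add: gen_def)
qed

lemma word_prod_gen: "word_prod A5 (map (gen i) w) = perm_fun (evaluate (coords ! i) w)"
  by (induction w)
    (simp_all add: evaluate_def perm_fun_identity alt_group_one alt_group_mult gen_def
      perm_fun_compose)

lemma card_A5: "card (carrier A5) = 60"
  using alt_group_card_carrier[of 5] by (simp add: fact_numeral)

lemma set_pair_products:
  "set (pair_products ps) = (\<lambda>(p, q). compose p q) ` (insert identity (set ps) \<times> insert identity (set ps))"
  by (simp only: pair_products_def set_remdups set_map set_product list.set)

lemma distinct_pair_products: "distinct (pair_products ps)"
  by (simp only: pair_products_def distinct_remdups)

lemma evaluate_Nil [simp]: "evaluate c [] = identity"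
  by (simp add: evaluate_def)

text \<open>Associativity of \<open>compose\<close> is borrowed from composition of functions
  through the injection \<open>perm_fun\<close>, which avoids a case analysis on tables.\<close>

lemma evaluate_append: "evaluate c (v @ w) = compose (evaluate c v) (evaluate c w)"
proof (rule injD[OF inj_perm_fun])
  show "perm_fun (evaluate c (v @ w)) = perm_fun (compose (evaluate c v) (evaluate c w))"
    by (induction v) (simp_all add: evaluate_def perm_fun_identity perm_fun_compose o_assoc)
qed

lemma layer:
  assumes k: "k < 8" and g: "g \<in> carrier A5"
  shows "\<exists>u. length u \<le> 2 * layer_lengths ! k \<and> (\<forall>i<k. word_prod A5 (map (gen i) u) = \<one>\<^bsub>A5\<^esub>) \<and>
    word_prod A5 (map (gen k) u) = g"
proof -
  \<comment> \<open>The empty word is the counterpart of the \<open>identity\<close> adjoined in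
    \<open>pair_products\<close>.\<close>
  define W where "W = insert [] (set (layers ! k))"
  define c where "c = coords ! k"
  define P where "P = set (pair_products (map (evaluate c) (layers ! k)))"
  have "insert identity (set (map (evaluate c) (layers ! k))) = evaluate c ` W"
    by (simp add: W_def)
  then have P: "P = (\<lambda>(v, w). evaluate c (v @ w)) ` (W \<times> W)"
    unfolding P_def set_pair_products evaluate_append by (auto simp: image_iff)
  have "card P = 60"
    using layers_cover k distinct_card[OF distinct_pair_products]
    by (simp add: P_def c_def list_all_iff)
  \<comment> \<open>Each value is a product of generators in A_5, so closure replaces any
    computation of parity.\<close>
  have "perm_fun p \<in> carrier A5" if "p \<in> P" for p
  proof -
    interpret A5: group A5
      by (rule alt_group_is_group)
    obtain w where "p = evaluate c w"
      using \<open>p \<in> P\<close> unfolding P by auto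
    then have "perm_fun p = word_prod A5 (map (gen k) w)"
      by (simp add: word_prod_gen c_def)
    then show ?thesis
      using gen_in_A5[OF k] by (auto intro!: A5.word_prod_closed)
  qed
  then have "perm_fun ` P \<subseteq> carrier A5"
    by blast
  moreover have "card (perm_fun ` P) = 60"
    using \<open>card P = 60\<close> by (simp add: card_image inj_on_subset[OF inj_perm_fun])
  \<comment> \<open>An infinite set has \<open>card\<close> 0, so the order 60 forces
    finiteness.\<close>
  moreover have "finite (carrier A5)"
    using card_A5 card.infinite by fastforce
  ultimately have "perm_fun ` P = carrier A5"
    using card_A5 by (intro card_subset_eq) auto
  then have "g \<in> perm_fun ` P"
    using g by simp
  then obtain v w where vw: "v \<in> W" "w \<in> W" "perm_fun (evaluate c (v @ w)) = g"
    unfolding P by auto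
  have "evaluate (coords ! i) u = identity" if "i < k" "u \<in> W" for i u
  proof -
    have "coords ! i \<in> set (take k coords)"
      using that k by (auto simp: in_set_conv_nth intro!: exI[of _ i])
    then show ?thesis
      using layers_trivial_before that k by (auto simp: W_def list_all_iff evaluate_def)
  qed
  then have "word_prod A5 (map (gen i) (v @ w)) = \<one>\<^bsub>A5\<^esub>" if "i < k" for i
    unfolding word_prod_gen evaluate_append using that vw
    by (simp add: perm_fun_identity alt_group_one)
  moreover have "length (v @ w) \<le> 2 * layer_lengths ! k"
  proof -
    have "length u \<le> layer_lengths ! k" if "u \<in> W" for u
      using layers_short that k by (auto simp: W_def list_all_iff)
    from this[OF vw(1)] this[OF vw(2)] show ?thesis
      by simp
  qed
  ultimately show ?thesis
    using vw by (intro exI[of _ "v @ w"]) (auto simp only: word_prod_gen c_def)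
qed

section \<open>The sets C_n and the final bound\<close>

lemma one_to_eight_cases:
  assumes "1 \<le> n" "n \<le> (8::nat)"
  shows "n = 1 \<or> n = 2 \<or> n = 3 \<or> n = 4 \<or> n = 5 \<or> n = 6 \<or> n = 7 \<or> n = 8"
  using assms by auto

lemma tuple_eq: "n = length xs \<Longrightarrow> (\<And>i. i < n \<Longrightarrow> xs ! i = f i) \<Longrightarrow> tuple xs = (\<lambda>i\<in>{..<n}. f i)"
  by (auto simp: tuple_def fun_eq_iff)

text \<open>Both generators of C_n are truncations of those of C_8, so the single family
  \<open>gen\<close> describes all eight sets.\<close>

lemma C_eq:
  assumes "1 \<le> n" "n \<le> 8"
  shows "C n = {\<lambda>i\<in>{..<n}. gen i X, \<lambda>i\<in>{..<n}. gen i Y}"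
proof -
  have gens: "(\<lambda>i\<in>{..<n}. gen i l) = tuple (take n (map (\<lambda>c. perm_fun (pick c l)) coords))" for l
    using assms by (intro tuple_eq[symmetric]) (auto simp: gen_def)
  show ?thesis
    unfolding gens C_def perm_a_eq perm_b_eq perm_c_eq perm_b2_eq coords_def Let_def
    using one_to_eight_cases[OF assms] by (elim disjE) simp_all
qed

text \<open>The factor 2 stands for the two words used per layer. The sums are 10, 32, 68, 116, 156,
  216, 280 and 392, the last being 49 * 8.\<close>

lemma sum_layer_lengths:
  assumes "1 \<le> n" "n \<le> 8"
  shows "(\<Sum>k<n. 2 * layer_lengths ! k) \<le> 58 * n"
  using one_to_eight_cases[OF assms]
  by (elim disjE) (simp_all add: layer_lengths_def lessThan_nat_numeral lessThan_Suc)

theorem theorem5p1: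
  fixes n :: nat
  assumes "1 \<le> n" and "n \<le> 8"
  shows "card (C n) = 2 \<and> generating_set (A5_power n) (C n) \<and> diam (A5_power n) (C n) \<le> 58 * n"
proof -
  define x where "x l = (\<lambda>i\<in>{..<n}. gen i l)" for l
  have C: "C n = {x X, x Y}"
    using C_eq[OF assms] by (simp add: x_def)
  \<comment> \<open>Coordinate 0 exists for every n in range and holds a and b, which differ; so the
    two generators are distinct.\<close>
  have "gen 0 X \<noteq> gen 0 Y"
    using injD[OF inj_perm_fun] by (auto simp: gen_def coords_def Let_def)
  then have "x X 0 \<noteq> x Y 0"
    using assms by (simp add: x_def)
  then have "card (C n) = 2"
    unfolding C by (metis card_2_iff)
  have x: "x l \<in> carrier (A5_power n)" for l
    using gen_in_A5 assms by (auto simp: x_def)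
  then have sub: "C n \<subseteq> carrier (A5_power n)"
    by (auto simp: C simp del: carrier_product_group)
  \<comment> \<open>This one statement yields both generation and the diameter bound.\<close>
  have words: "\<exists>ws. set ws \<subseteq> C n \<and> length ws \<le> 58 * n \<and> word_prod (A5_power n) ws = g"
    if g: "g \<in> carrier (A5_power n)" for g
  proof -
    have "\<exists>w. length w \<le> (\<Sum>k<n. 2 * layer_lengths ! k) \<and> (\<forall>i<n. word_prod A5 (map (gen i) w) = g i)"
    proof (rule triangular_words)
      show "g i \<in> carrier A5" if "i < n" for i
        using g that by auto
    qed (use assms in \<open>auto intro: alt_group_is_group gen_in_A5 layer\<close>)
    then obtain w where w: "length w \<le> (\<Sum>k<n. 2 * layer_lengths ! k)"
      "\<And>i. i < n \<Longrightarrow> word_prod A5 (map (gen i) w) = g i"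
      by blast
    have "word_prod (A5_power n) (map x w) = (\<lambda>i\<in>{..<n}. word_prod A5 (map (gen i) w))"
      unfolding x_def by (rule word_prod_product_group)
    also have "\<dots> = g"
      \<comment> \<open>Elements of the product are \<open>undefined\<close> outside
        \<open>{..<n}\<close>, so agreement at the indices below \<open>n\<close> is
        equality.\<close>
      using g w(2) by (auto simp: PiE_def extensional_def fun_eq_iff)
    finally have "word_prod (A5_power n) (map x w) = g" .
    moreover have "x l \<in> C n" for l
      by (cases l) (simp_all add: C)
    then have "set (map x w) \<subseteq> C n"
      by auto
    moreover have "length (map x w) \<le> 58 * n"
      using w(1) sum_layer_lengths[OF assms] by simp
    ultimately show ?thesis
      by blast
  qed
  then have "generating_set (A5_power n) (C n)"
    using sub unfolding generating_set_def by blast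
  moreover have "finite (carrier A5)"
    using card_A5 card.infinite by fastforce
  then have "finite (carrier (A5_power n))"
    by (simp add: finite_PiE)
  then have "diam (A5_power n) (C n) \<le> 58 * n"
    using sub C words by (intro diam_le) (auto simp del: carrier_product_group)
  ultimately show ?thesis
    using \<open>card (C n) = 2\<close> by simp
qed

end
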